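(* Let $\alpha\in(0,2]$, $\delta\in\mathbb{R}$, and let $\sigma\geq 0$ if $\alpha=1$ and $\sigma>0$ if $\alpha\neq 1$. Let $X$ be an extreme stable random variable $X\sim S_\alpha(\sigma,1,\delta)$ (skewness $\beta=1$), with distribution $F$, so that its bilateral Laplace-Stieltjes transform is, for $t\geq 0$, $$\mathcal{L}_X(t)=\mathbb{E}[\exp(-tX)]=\begin{cases}\exp\left(-t\delta-\sec\left(\frac{\pi\alpha}{2}\right)\sigma^\alpha t^\alpha\right) & \alpha\neq 1,\\ \exp\left(-t\delta+\sigma\frac{2}{\pi}t\log t\right) & \alpha=1.\end{cases}$$ If $$\delta\geq\begin{cases}-\alpha\sec\left(\frac{\pi\alpha}{2}\right)\sigma^\alpha & \alpha\neq 1,\\ \sigma\frac{2}{\pi} & \alpha=1,\end{cases}$$ then $X$ can be used as the mixing variable in a mixed Poisson distribution, i.e. $Poi\bigwedge F$ exists, and the probability generating function of the resulting mixed Poisson distribution is $$G(z)=\begin{cases}\exp\left((z-1)\delta-\sec\left(\frac{\pi\alpha}{2}\right)\sigma^\alpha(1-z)^\alpha\right) & \alpha\neq 1,\\ \exp\left((z-1)\delta+\sigma\frac{2}{\pi}(1-z)\log(1-z)\right) & \alpha=1,\end{cases}\qquad z\in[0,1].$$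
   Context: Convention: $0\log 0=0$. Notation: $\mathbb{N}_0=\{0,1,2,\dots\}$. Stable distributions: $X\sim S_\alpha(\sigma,\beta,\delta)$, with $\alpha\in(0,2]$, $\beta\in[-1,1]$, $\delta\in\mathbb{R}$, and $\sigma\ge 0$ if $\alpha=1$, $\sigma>0$ otherwise, means that $X$ is a real-valued random variable with characteristic function $$\mathbb{E}[e^{itX}]=\begin{cases}\exp\left[it\delta-\sigma^\alpha|t|^\alpha\left(1-i\beta\,\mathrm{sign}(t)\tan\frac{\alpha\pi}{2}\right)\right] & \alpha\neq 1,\\ \exp\left[it\delta-\sigma|t|\left(1+i\beta\frac{2}{\pi}\mathrm{sign}(t)\log|t|\right)\right] & \alpha=1.\end{cases}$$ The case $\beta=1$ is called extreme stable; it is a known fact that in that case the bilateral Laplace-Stieltjes transform $\mathcal{L}_X(t)=\mathbb{E}[\exp(-tX)]$ is finite for all $t\geq 0$ and given by the formula in the claim. A function $f$ on $\mathbb{N}_0$ is a valid probability mass function (PMF) if $f(n)\geq 0$ for all $n\in\mathbb{N}_0$ and $\sum_{n=0}^\infty f(n)=1$. For a real-valued random variable $X\sim F$ (not assumed nonnegative), the mixed Poisson distribution generated by $F$, denoted $Poi\bigwedge F$, is the distribution on $\mathbb{N}_0$ with PMF $f(n)=\mathbb{E}\left[X^n e^{-X}\right]/n!$, provided this $f$ is a valid PMF (in particular each expectation must be well defined and finite). The mixed Poisson distribution $Poi\bigwedge F$ is said to exist if this $f$ is a valid PMF. The probability generating function (PGF) of an $\mathbb{N}_0$-valued random variable $Y$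 is $G_Y(z)=\mathbb{E}[z^Y]=\sum_{n=0}^\infty z^n\Pr(Y=n)$. *)

theory Defs
  imports "HOL-Probability.Probability"
begin

definition sec :: "real \<Rightarrow> real" where
  "sec x = 1 / cos x"

text \<open>
  The characteristic function of \<open>S\<^sub>\<alpha>(\<sigma>, \<beta>, \<delta>)\<close>.  At \<open>t = 0\<close> the library conventions
  \<open>ln 0 = 0\<close> and \<open>0 powr a = 0\<close> give the intended value 1 (in particular \<open>0 log 0 = 0\<close>).
\<close>
definition stable_char :: "real \<Rightarrow> real \<Rightarrow> real \<Rightarrow> real \<Rightarrow> real \<Rightarrow> complex" where
  "stable_char \<alpha> \<sigma> \<beta> \<delta> t =
     (if \<alpha> \<noteq> 1
      then exp (\<i> * of_real (t * \<delta>)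
                - of_real (\<sigma> powr \<alpha> * \<bar>t\<bar> powr \<alpha>)
                  * (1 - \<i> * of_real (\<beta> * sgn t * tan (\<alpha> * pi / 2))))
      else exp (\<i> * of_real (t * \<delta>)
                - of_real (\<sigma> * \<bar>t\<bar>)
                  * (1 + \<i> * of_real (\<beta> * (2 / pi) * sgn t * ln \<bar>t\<bar>))))"

definition stable_distribution ::
    "real \<Rightarrow> real \<Rightarrow> real \<Rightarrow> real \<Rightarrow> real measure \<Rightarrow> bool" where
  "stable_distribution \<alpha> \<sigma> \<beta> \<delta> F \<longleftrightarrow>
     0 < \<alpha> \<and> \<alpha> \<le> 2 \<and> -1 \<le> \<beta> \<and> \<beta> \<le> 1 \<and> (if \<alpha> = 1 then 0 \<le> \<sigma> else 0 < \<sigma>) \<and>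
     real_distribution F \<and> (\<forall>t. char F t = stable_char \<alpha> \<sigma> \<beta> \<delta> t)"

text \<open>
  A Bochner integral is 0 when the integrand is not integrable, so statements about
  \<open>bilateral_laplace\<close> and \<open>mixed_poisson_fun\<close> must be accompanied by integrability.
\<close>
definition bilateral_laplace :: "real measure \<Rightarrow> real \<Rightarrow> real" where
  "bilateral_laplace F t = (\<integral>x. exp (- t * x) \<partial>F)"

definition valid_pmf :: "(nat \<Rightarrow> real) \<Rightarrow> bool" where
  "valid_pmf f \<longleftrightarrow> (\<forall>n. 0 \<le> f n) \<and> f sums 1"

definition mixed_poisson_fun :: "real measure \<Rightarrow> nat \<Rightarrow> real" where
  "mixed_poisson_fun F n = (\<integral>x. x ^ n * exp (- x) \<partial>F) / fact n"

definition mixed_poisson_exists :: "real measure \<Rightarrow> bool" where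
  "mixed_poisson_exists F \<longleftrightarrow>
     (\<forall>n. integrable F (\<lambda>x. x ^ n * exp (- x))) \<and> valid_pmf (mixed_poisson_fun F)"

text \<open>Only meaningful if \<open>mixed_poisson_exists F\<close>; see \<open>pmf_mixed_poisson\<close>.\<close>
definition mixed_poisson :: "real measure \<Rightarrow> nat pmf" where
  "mixed_poisson F = embed_pmf (mixed_poisson_fun F)"

lemma pmf_mixed_poisson:
  assumes "mixed_poisson_exists F"
  shows "pmf (mixed_poisson F) n = mixed_poisson_fun F n"
proof -
  from assms have nonneg: "0 \<le> mixed_poisson_fun F k" and sums: "mixed_poisson_fun F sums 1" for k
    by (auto simp: mixed_poisson_exists_def valid_pmf_def)
  have "(\<integral>\<^sup>+k. ennreal (mixed_poisson_fun F k) \<partial>count_space UNIV)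
        = (\<Sum>k. ennreal (mixed_poisson_fun F k))"
    by (rule nn_integral_count_space_nat)
  also have "\<dots> = ennreal (\<Sum>k. mixed_poisson_fun F k)"
    using nonneg sums by (intro suminf_ennreal2) (auto dest: sums_summable)
  also have "\<dots> = 1"
    using sums by (simp add: sums_unique[symmetric])
  finally show ?thesis
    unfolding mixed_poisson_def using nonneg by (intro pmf_embed_pmf)
qed

definition pgf :: "nat pmf \<Rightarrow> real \<Rightarrow> real" where
  "pgf p z = measure_pmf.expectation p (\<lambda>n. z ^ n)"

end

theory Submission
  imports Defs "HOL-Complex_Analysis.Complex_Analysis"
begin

text \<open>
  The claimed transform extends to a function \<open>\<Phi>\<close> that is continuous on the closed right half-plane,
  holomorphic inside, of growth \<open>exp (A + B |s|\<^sup>2)\<close>, and equal to the characteristic function on the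
  imaginary axis.  Writing the Gaussian-damped exponential \<open>exp (- t x - a\<^sup>2 x\<^sup>2 / 2)\<close> as a superposition
  of characters, Fubini's theorem and a shift of the line of integration from \<open>Re s = 0\<close> to
  \<open>Re s = t\<close> express its expectation as a Gaussian average of \<open>\<Phi>\<close> over \<open>Re s = t\<close>; letting
  \<open>a \<rightarrow> 0\<close>, monotone convergence gives both finiteness and the value \<open>\<Phi> t\<close> of the transform.

  Expanding \<open>exp (- (1 - z) x)\<close> in powers of \<open>z\<close> identifies the mixed Poisson weights as the
  coefficients of \<open>\<Phi> (1 - z)\<close>, with dominated convergence up to \<open>z = 1\<close>.  They are nonnegative
  because the logarithmic derivative of \<open>\<Phi> (1 - z)\<close> has nonnegative coefficients: the bound on \<open>\<delta>\<close>
  says exactly that its constant coefficient is nonnegative.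
\<close>

section \<open>Shifting a Gaussian line integral\<close>

text \<open>Cauchy's theorem on the rectangles 0 \<le> Re s \<le> \<tau>, |Im s| \<le> n, phrased
  with a primitive on the closed strip. The horizontal sides contribute at most
  \<open>\<tau>\<close> times \<open>h\<close> at heights n and -n, which vanishes in the limit.
  Only continuity is asked on the boundary lines because the transform treated later may have a
  branch point at 0.\<close>

lemma vertical_line_integral_shift:
  fixes g :: "complex \<Rightarrow> complex" and h :: "real \<Rightarrow> real"
  assumes \<tau>: "0 \<le> \<tau>"
    and cont: "continuous_on {s. 0 \<le> Re s \<and> Re s \<le> \<tau>} g"
    and holo: "g holomorphic_on {s. 0 < Re s \<and> Re s < \<tau>}"
    and bound: "\<And>s. 0 \<le> Re s \<Longrightarrow> Re s \<le> \<tau> \<Longrightarrow> norm (g s) \<le> h (Im s)"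
    and h: "integrable lborel h" "(h \<longlongrightarrow> 0) at_top" "(h \<longlongrightarrow> 0) at_bot"
  shows "(\<integral>y. g (Complex 0 y) \<partial>lborel) = (\<integral>y. g (Complex \<tau> y) \<partial>lborel)"
proof -
  let ?S = "{s. 0 \<le> Re s \<and> Re s \<le> \<tau>}"
  have S_eq: "?S = {s. 0 \<le> Re s} \<inter> {s. Re s \<le> \<tau>}" by auto
  have convex: "convex ?S"
    unfolding S_eq by (intro convex_Int convex_halfspace_Re_ge convex_halfspace_Re_le)
  have int_S: "interior ?S = {s. 0 < Re s \<and> Re s < \<tau>}"
    unfolding S_eq interior_Int
    using interior_halfspace_ge[of "1::complex" 0] interior_halfspace_le[of "1::complex" \<tau>]
    by (auto simp: inner_complex_def)
  have "open {s. 0 < Re s \<and> Re s < \<tau>}"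
    by (metis int_S open_interior)
  with holo have diff: "g field_differentiable at s" if "s \<in> interior ?S - {}" for s
    using that unfolding int_S by (auto simp: holomorphic_on_open field_differentiable_def)
  obtain P where P: "\<And>s. s \<in> ?S \<Longrightarrow> (P has_field_derivative g s) (at s within ?S)"
    using holomorphic_convex_primitive[OF convex finite.emptyI cont diff] by blast
  define D where "D x n = (\<integral>y. indicator {- real n..real n} y *\<^sub>R g (Complex x y) \<partial>lborel)" for x n
  have cont_line: "continuous_on A (\<lambda>y. g (Complex x y))" if "0 \<le> x" "x \<le> \<tau>" for x A
    by (rule continuous_on_compose2[OF cont])
       (use that in \<open>auto simp: Complex_eq intro!: continuous_intros\<close>)
  \<comment> \<open>The factor \<open>\<i>\<close> comes from ds = i dy along a vertical
    line.\<close>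
  have D_eq: "\<i> * D x n = P (Complex x (real n)) - P (Complex x (- real n))"
    if x: "0 \<le> x" "x \<le> \<tau>" for x n
  proof -
    have deriv: "((\<lambda>y. P (Complex x y)) has_vector_derivative \<i> * g (Complex x y)) (at y within A)" for y A
    proof -
      have d: "(Complex x has_vector_derivative \<i>) (at y within A)"
        unfolding Complex_eq has_vector_derivative_def
        by (auto intro!: derivative_eq_intros simp: scaleR_conv_of_real)
      have p: "(P has_field_derivative g (Complex x y)) (at (Complex x y) within Complex x ` A)"
        by (rule has_field_derivative_subset[OF P]) (use x in auto)
      have "(P \<circ> Complex x has_vector_derivative \<i> * g (Complex x y)) (at y within A)"
        by (rule field_vector_diff_chain_within[OF d p])
      then show ?thesis
        by (simp add: comp_def)
    qed
    have "\<i> * D x n = (\<integral>y. indicator {- real n..real n} y *\<^sub>R (\<i> * g (Complex x y)) \<partial>lborel)"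
      unfolding D_def by (subst integral_mult_right_zero[symmetric]) (simp add: mult_ac scaleR_conv_of_real)
    also have "\<dots> = P (Complex x (real n)) - P (Complex x (- real n))"
      by (rule integral_FTC_atLeastAtMost)
         (use x in \<open>auto intro!: deriv continuous_intros cont_line\<close>)
    finally show ?thesis .
  qed
  have D_lim: "D x \<longlonglongrightarrow> (\<integral>y. g (Complex x y) \<partial>lborel)" if x: "0 \<le> x" "x \<le> \<tau>" for x
    unfolding D_def
  proof (rule integral_dominated_convergence[where w = h])
    have [measurable]: "(\<lambda>y. g (Complex x y)) \<in> borel_measurable borel"
      by (intro borel_measurable_continuous_onI cont_line x)
    show "(\<lambda>y. g (Complex x y)) \<in> borel_measurable lborel" by simp
    show "(\<lambda>y. indicator {- real n..real n} y *\<^sub>R g (Complex x y)) \<in> borel_measurable lborel" for n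
      by simp
    show "AE y in lborel. norm (indicator {- real n..real n} y *\<^sub>R g (Complex x y)) \<le> h y" for n
    proof (intro AE_I2)
      fix y
      have *: "norm (g (Complex x y)) \<le> h y"
        using bound[of "Complex x y"] x by simp
      then show "norm (indicator {- real n..real n} y *\<^sub>R g (Complex x y)) \<le> h y"
        using order_trans[OF norm_ge_zero *] by (simp add: indicator_def)
    qed
    show "AE y in lborel. (\<lambda>n. indicator {- real n..real n} y *\<^sub>R g (Complex x y))
            \<longlonglongrightarrow> g (Complex x y)"
    proof (intro AE_I2 tendsto_eventually)
      fix y :: real
      obtain N where N: "\<bar>y\<bar> \<le> real N" using real_arch_simple by blast
      show "\<forall>\<^sub>F n in sequentially. indicator {- real n..real n} y *\<^sub>R g (Complex x y) = g (Complex x y)"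
        using eventually_ge_at_top[of N]
        by eventually_elim (use N in \<open>auto simp: indicator_def\<close>)
    qed
  qed (fact h)
  \<comment> \<open>Mean value bound for \<open>P\<close> along the horizontal segment at height y,
    on which |P'| = |g| \<le> h y.\<close>
  have P_bound: "norm (P (Complex \<tau> y) - P (Complex 0 y)) \<le> \<tau> * h y" for y
  proof -
    let ?T = "{s. 0 \<le> Re s \<and> Re s \<le> \<tau> \<and> Im s = y}"
    have T_eq: "?T = ?S \<inter> {s. Im s = y}" by auto
    have "convex {s. Im s = y}"
      using convex_hyperplane[of \<i> y] by (simp add: inner_complex_def)
    then have "convex ?T"
      unfolding T_eq by (intro convex_Int convex)
    then have "norm (P (Complex \<tau> y) - P (Complex 0 y)) \<le> h y * norm (Complex \<tau> y - Complex 0 y)"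
      by (rule field_differentiable_bound[where f' = g])
         (use bound \<tau> in \<open>auto intro: has_field_derivative_subset[OF P]\<close>)
    moreover have "Complex \<tau> y - Complex 0 y = of_real \<tau>"
      by (simp add: complex_eq_iff)
    ultimately show ?thesis using \<tau> by (simp add: mult.commute)
  qed
  have "(\<lambda>n. D \<tau> n - D 0 n) \<longlonglongrightarrow> 0"
  proof (rule Lim_null_comparison)
    show "\<forall>\<^sub>F n in sequentially. norm (D \<tau> n - D 0 n) \<le> \<tau> * h (real n) + \<tau> * h (- real n)"
    proof (intro always_eventually allI)
      fix n
      have "norm (D \<tau> n - D 0 n) = norm (\<i> * D \<tau> n - \<i> * D 0 n)"
        by (simp add: right_diff_distrib[symmetric] norm_mult)
      \<comment> \<open>The four corner values of \<open>P\<close> are regrouped from vertical into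
        horizontal pairs.\<close>
      also have "\<dots> = norm ((P (Complex \<tau> (real n)) - P (Complex 0 (real n)))
                      - (P (Complex \<tau> (- real n)) - P (Complex 0 (- real n))))"
        using \<tau> by (simp add: D_eq algebra_simps)
      also have "\<dots> \<le> \<tau> * h (real n) + \<tau> * h (- real n)"
        using P_bound[of "real n"] P_bound[of "- real n"] norm_triangle_ineq4 by (smt (verit))
      finally show "norm (D \<tau> n - D 0 n) \<le> \<tau> * h (real n) + \<tau> * h (- real n)" .
    qed
    have "(\<lambda>n. h (real n)) \<longlonglongrightarrow> 0"
      by (rule filterlim_compose[OF h(2) filterlim_real_sequentially])
    moreover have "(\<lambda>n. h (- real n)) \<longlonglongrightarrow> 0"
      by (rule filterlim_compose[OF h(3)
            filterlim_compose[OF filterlim_uminus_at_bot_at_top filterlim_real_sequentially]])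
    ultimately show "(\<lambda>n. \<tau> * h (real n) + \<tau> * h (- real n)) \<longlonglongrightarrow> 0"
      by (auto intro!: tendsto_eq_intros)
  qed
  moreover have "(\<lambda>n. D \<tau> n - D 0 n) \<longlonglongrightarrow>
      (\<integral>y. g (Complex \<tau> y) \<partial>lborel) - (\<integral>y. g (Complex 0 y) \<partial>lborel)"
    using \<tau> by (intro tendsto_diff D_lim) auto
  ultimately show ?thesis
    using LIMSEQ_unique by fastforce
qed

lemma integrable_exp_neg_square:
  fixes c :: real
  assumes "0 < c"
  shows "integrable lborel (\<lambda>u. exp (- (u\<^sup>2 * c)))"
proof -
  define \<sigma> where "\<sigma> = sqrt (1 / (2 * c))"
  have \<sigma>: "0 < \<sigma>" "\<sigma>\<^sup>2 = 1 / (2 * c)"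
    using assms by (simp_all add: \<sigma>_def)
  have "integrable lborel (\<lambda>u. sqrt (2 * pi * \<sigma>\<^sup>2) * normal_density 0 \<sigma> u)"
    using \<sigma> by (intro integrable_mult_right integrable_normal_density)
  moreover have "sqrt (2 * pi * \<sigma>\<^sup>2) * normal_density 0 \<sigma> u = exp (- (u\<^sup>2 * c))" for u
    using \<sigma> assms by (simp add: normal_density_def)
  ultimately show ?thesis by simp
qed

text \<open>The characteristic function of the standard normal law, freed of the factor 1 / sqrt (2
  pi) in the density.\<close>

lemma integral_iexp_gaussian:
  "(\<integral>u. iexp (v * u) * of_real (exp (- (u\<^sup>2 / 2))) \<partial>lborel)
     = complex_of_real (sqrt (2 * pi) * exp (- (v\<^sup>2 / 2)))"
proof -
  have "char std_normal_distribution v = (\<integral>u. std_normal_density u *\<^sub>R iexp (v * u) \<partial>lborel)"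
    unfolding char_def by (subst integral_density) auto
  also have "\<dots> = (\<integral>u. of_real (1 / sqrt (2 * pi)) * (iexp (v * u) * of_real (exp (- (u\<^sup>2 / 2)))) \<partial>lborel)"
    by (simp add: std_normal_density_def scaleR_conv_of_real mult_ac)
  also have "\<dots> = of_real (1 / sqrt (2 * pi)) * (\<integral>u. iexp (v * u) * of_real (exp (- (u\<^sup>2 / 2))) \<partial>lborel)"
    by (rule integral_mult_right_zero)
  finally have "(\<integral>u. iexp (v * u) * of_real (exp (- (u\<^sup>2 / 2))) \<partial>lborel)
      = of_real (sqrt (2 * pi)) * char std_normal_distribution v"
    by simp
  then show ?thesis
    by (simp add: char_std_normal_distribution)
qed

text \<open>The kernel exp ((s - \<tau>)^2 / 2) is a real Gaussian exactly on the line Re s =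
  \<tau>. On every vertical line it decays like exp (- u^2 / 2), and \<open>B \<le> 1 / 4\<close>
  ensures that the growth of \<open>\<Psi>\<close> uses up at most half of this decay.\<close>

lemma gaussian_line_integral_shift:
  fixes \<Psi> :: "complex \<Rightarrow> complex" and A B \<tau> :: real
  assumes \<tau>: "0 \<le> \<tau>"
    and cont: "continuous_on {s. 0 \<le> Re s} \<Psi>"
    and holo: "\<Psi> holomorphic_on {s. 0 < Re s}"
    and bound: "\<And>s. 0 \<le> Re s \<Longrightarrow> norm (\<Psi> s) \<le> exp (A + B * (norm s)\<^sup>2)"
    and B: "0 \<le> B" "B \<le> 1 / 4"
  shows "(\<integral>u. \<Psi> (Complex 0 u) * exp ((Complex 0 u - of_real \<tau>)\<^sup>2 / 2) \<partial>lborel)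
       = (\<integral>u. \<Psi> (Complex \<tau> u) * of_real (exp (- (u\<^sup>2 / 2))) \<partial>lborel)"
proof -
  define g where "g s = \<Psi> s * exp ((s - of_real \<tau>)\<^sup>2 / 2)" for s
  \<comment> \<open>In the exponent, B \<tau>^2 bounds the growth due to Re s, \<tau>^2 / 2 bounds
    (Re s - \<tau>)^2 / 2, and - u^2 / 4 is what remains of - u^2 / 2 after the growth due to Im
    s.\<close>
  define h where "h u = exp (A + B * \<tau>\<^sup>2 + \<tau>\<^sup>2 / 2) * exp (- (u\<^sup>2 * (1 / 4)))" for u :: real
  have "(\<integral>u. g (Complex 0 u) \<partial>lborel) = (\<integral>u. g (Complex \<tau> u) \<partial>lborel)"
  proof (rule vertical_line_integral_shift[OF \<tau>])
    show "continuous_on {s. 0 \<le> Re s \<and> Re s \<le> \<tau>} g"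
      unfolding g_def by (intro continuous_intros continuous_on_subset[OF cont]) auto
    show "g holomorphic_on {s. 0 < Re s \<and> Re s < \<tau>}"
      unfolding g_def by (intro holomorphic_intros holomorphic_on_subset[OF holo]) auto
    show "integrable lborel h"
      unfolding h_def by (intro integrable_mult_right integrable_exp_neg_square) simp
    show "(h \<longlongrightarrow> 0) at_top" "(h \<longlongrightarrow> 0) at_bot"
      unfolding h_def by real_asymp+
    fix s assume s: "0 \<le> Re s" "Re s \<le> \<tau>"
    have sq: "(Re s)\<^sup>2 \<le> \<tau>\<^sup>2" "(Re s - \<tau>)\<^sup>2 \<le> \<tau>\<^sup>2"
      using s by (auto intro!: power_mono simp: power2_commute[of "Re s"])
    have "norm (g s) = norm (\<Psi> s) * exp (((Re s - \<tau>)\<^sup>2 - (Im s)\<^sup>2) / 2)"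
      by (simp add: g_def norm_mult power2_eq_square)
    also have "\<dots> \<le> exp (A + B * (norm s)\<^sup>2) * exp (((Re s - \<tau>)\<^sup>2 - (Im s)\<^sup>2) / 2)"
      using bound s by (intro mult_right_mono) auto
    also have "\<dots> \<le> h (Im s)"
    proof -
      have "B * (Re s)\<^sup>2 \<le> B * \<tau>\<^sup>2" "B * (Im s)\<^sup>2 \<le> 1 / 4 * (Im s)\<^sup>2"
        by (rule mult_left_mono[OF sq(1) B(1)], rule mult_right_mono[OF B(2)]) simp
      with sq show ?thesis
        by (simp add: h_def exp_add[symmetric] cmod_power2 distrib_left diff_divide_distrib)
    qed
    finally show "norm (g s) \<le> h (Im s)" .
  qed
  moreover have "g (Complex \<tau> u) = \<Psi> (Complex \<tau> u) * of_real (exp (- (u\<^sup>2 / 2)))" for u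
  proof -
    have "(Complex \<tau> u - of_real \<tau>)\<^sup>2 / 2 = of_real (- (u\<^sup>2 / 2))"
      by (simp add: complex_eq_iff power2_eq_square)
    then show ?thesis by (simp only: g_def exp_of_real)
  qed
  ultimately have "(\<integral>u. g (Complex 0 u) \<partial>lborel)
      = (\<integral>u. \<Psi> (Complex \<tau> u) * of_real (exp (- (u\<^sup>2 / 2))) \<partial>lborel)"
    by (simp only:)
  then show ?thesis unfolding g_def .
qed

section \<open>Laplace transforms from characteristic functions\<close>

text \<open>With \<tau> = t / a and the kernel \<open>K\<close>, the function sqrt (2 pi) exp (- t x
  - (a x)^2 / 2) is the integral over u of exp (- i a x u) K u. Integrating against \<open>F\<close>
  turns the characters into values of \<open>\<Phi>\<close> on the imaginary axis, and a second
  shift moves these to Re s = t. The condition on B a^2 is the growth condition of the shift lemma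
  for the rescaled function \<Phi> (a s).\<close>

lemma gaussian_regularized_laplace:
  fixes \<Phi> :: "complex \<Rightarrow> complex" and F :: "real measure" and A B a t :: real
  assumes F: "real_distribution F"
    and cont: "continuous_on {s. 0 \<le> Re s} \<Phi>"
    and holo: "\<Phi> holomorphic_on {s. 0 < Re s}"
    and bound: "\<And>s. 0 \<le> Re s \<Longrightarrow> norm (\<Phi> s) \<le> exp (A + B * (norm s)\<^sup>2)"
    and char_F: "\<And>u. char F u = \<Phi> (Complex 0 (- u))"
    and t: "0 \<le> t" and a: "0 < a" and B: "0 \<le> B" "B * a\<^sup>2 \<le> 1 / 4"
  shows "integrable F (\<lambda>x. exp (- t * x - (a * x)\<^sup>2 / 2))"
    and "complex_of_real (\<integral>x. exp (- t * x - (a * x)\<^sup>2 / 2) \<partial>F)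
       = (\<integral>u. of_real (std_normal_density u) * \<Phi> (Complex t (a * u)) \<partial>lborel)"
proof -
  interpret F: real_distribution F by (rule F)
  interpret FL: pair_sigma_finite lborel F ..
  define \<tau> where "\<tau> = t / a"
  have \<tau>: "0 \<le> \<tau>" "a * \<tau> = t"
    using t a by (simp_all add: \<tau>_def)
  define K where "K u = exp ((Complex 0 u - of_real \<tau>)\<^sup>2 / 2)" for u
  have norm_K: "norm (K u) = exp (\<tau>\<^sup>2 / 2) * exp (- (u\<^sup>2 * (1 / 2)))" for u
    by (simp add: K_def power2_eq_square exp_add[symmetric] exp_diff[symmetric] field_simps)
  have int_norm_K: "integrable lborel (\<lambda>u. norm (K u))"
    unfolding norm_K by (intro integrable_mult_right integrable_exp_neg_square) simp
  have K_meas [measurable]: "K \<in> borel_measurable borel"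
    unfolding K_def Complex_eq by (intro borel_measurable_continuous_onI continuous_intros) auto
  define e where "e x u = iexp (- (a * x) * u)" for x u
  have e_eq: "e x u = exp (- of_real (a * x) * Complex 0 u)" for x u
    by (simp add: e_def Complex_eq mult_ac)

  show int: "integrable F (\<lambda>x. exp (- t * x - (a * x)\<^sup>2 / 2))"
  proof (rule F.integrable_const_bound[where B = "exp (\<tau>\<^sup>2 / 2)"])
    have "- t * x - (a * x)\<^sup>2 / 2 \<le> \<tau>\<^sup>2 / 2" for x
    proof -
      have "0 \<le> (a * x + \<tau>)\<^sup>2 / 2" by simp
      also have "\<dots> = \<tau>\<^sup>2 / 2 - (- t * x - (a * x)\<^sup>2 / 2)"
        by (simp add: power2_eq_square field_simps flip: \<tau>(2))
      finally show ?thesis by simp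
    qed
    then show "AE x in F. norm (exp (- t * x - (a * x)\<^sup>2 / 2)) \<le> exp (\<tau>\<^sup>2 / 2)"
      by simp
  qed simp

  \<comment> \<open>First use of the shift, for fixed x: on Re s = \<tau> the integrand splits into
    exp (- t x) and the Fourier integrand of a Gaussian at frequency - a x.\<close>
  have inner_u: "(\<integral>u. e x u * K u \<partial>lborel) = of_real (sqrt (2 * pi) * exp (- t * x - (a * x)\<^sup>2 / 2))" for x
  proof -
    have "(\<integral>u. e x u * K u \<partial>lborel)
        = (\<integral>u. exp (- of_real (a * x) * Complex \<tau> u) * of_real (exp (- (u\<^sup>2 / 2))) \<partial>lborel)"
      unfolding K_def e_eq
    proof (rule gaussian_line_integral_shift[OF \<tau>(1), where \<Psi> = "\<lambda>s. exp (- of_real (a * x) * s)"])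
      fix s :: complex
      have "norm (exp (- of_real (a * x) * s)) \<le> exp (norm (- of_real (a * x) * s))"
        by (rule norm_exp)
      \<comment> \<open>The linear exponent is traded for a quadratic one whose coefficient 1/4 is
        the largest that the shift lemma admits; the price (a x)^2 is constant in s.\<close>
      also have "\<dots> \<le> exp ((a * x)\<^sup>2 + 1 / 4 * (norm s)\<^sup>2)"
      proof -
        have "0 \<le> (\<bar>a * x\<bar> - norm s / 2)\<^sup>2" by simp
        also have "\<dots> = (a * x)\<^sup>2 + 1 / 4 * (norm s)\<^sup>2 - \<bar>a * x\<bar> * norm s"
          by (simp add: power2_eq_square field_simps)
        finally show ?thesis by (simp add: norm_mult flip: abs_mult)
      qed
      finally show "norm (exp (- of_real (a * x) * s)) \<le> exp ((a * x)\<^sup>2 + 1 / 4 * (norm s)\<^sup>2)" .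
    qed (auto intro!: continuous_intros holomorphic_intros)
    also have "\<dots> = (\<integral>u. of_real (exp (- t * x)) * (iexp (- (a * x) * u) * of_real (exp (- (u\<^sup>2 / 2)))) \<partial>lborel)"
    proof (rule Bochner_Integration.integral_cong)
      fix u
      have "- of_real (a * x) * Complex \<tau> u = of_real (- t * x) + \<i> * of_real (- (a * x) * u)"
        by (simp add: complex_eq_iff flip: \<tau>(2))
      then show "exp (- of_real (a * x) * Complex \<tau> u) * of_real (exp (- (u\<^sup>2 / 2)))
          = of_real (exp (- t * x)) * (iexp (- (a * x) * u) * of_real (exp (- (u\<^sup>2 / 2))))"
        by (simp only: exp_add exp_of_real mult.assoc)
    qed simp
    also have "\<dots> = of_real (exp (- t * x)) * of_real (sqrt (2 * pi) * exp (- ((- (a * x))\<^sup>2 / 2)))"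
      by (simp only: integral_mult_right_zero integral_iexp_gaussian)
    also have "\<dots> = of_real (sqrt (2 * pi) * exp (- t * x - (a * x)\<^sup>2 / 2))"
      unfolding of_real_mult[symmetric]
      by (simp only: diff_conv_add_uminus exp_add power2_minus mult_ac)
    finally show ?thesis .
  qed

  \<comment> \<open>The characters have modulus 1 and \<open>F\<close> has mass 1, so joint
    integrability reduces to that of \<open>K\<close>.\<close>
  have "integrable (lborel \<Otimes>\<^sub>M F) (\<lambda>(u, x). e x u * K u)"
  proof (rule FL.Fubini_integrable)
    show "(\<lambda>(u, x). e x u * K u) \<in> borel_measurable (lborel \<Otimes>\<^sub>M F)"
      unfolding e_def by measurable
    have "(\<lambda>u. \<integral>x. norm (case (u, x) of (u, x) \<Rightarrow> e x u * K u) \<partial>F) = (\<lambda>u. norm (K u))"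
      by (simp add: e_def norm_mult F.prob_space[simplified])
    with int_norm_K show "integrable lborel (\<lambda>u. \<integral>x. norm (case (u, x) of (u, x) \<Rightarrow> e x u * K u) \<partial>F)"
      by simp
    show "AE u in lborel. integrable F (\<lambda>x. case (u, x) of (u, x) \<Rightarrow> e x u * K u)"
    proof (intro AE_I2)
      fix u
      have "integrable F (\<lambda>x. e x u)"
        unfolding e_def by (rule F.integrable_iexp) auto
      then show "integrable F (\<lambda>x. case (u, x) of (u, x) \<Rightarrow> e x u * K u)"
        by simp
    qed
  qed
  then have "(\<integral>x. \<integral>u. e x u * K u \<partial>lborel \<partial>F) = (\<integral>u. \<integral>x. e x u * K u \<partial>F \<partial>lborel)"
    by (rule FL.Fubini_integral)
  also have "\<dots> = (\<integral>u. \<Phi> (of_real a * Complex 0 u) * K u \<partial>lborel)"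
  proof (rule Bochner_Integration.integral_cong)
    fix u
    have "(\<integral>x. e x u \<partial>F) = char F (- (a * u))"
      by (simp add: char_def e_def mult_ac)
    also have "\<dots> = \<Phi> (of_real a * Complex 0 u)"
      unfolding char_F by (rule arg_cong[where f = \<Phi>]) (simp add: complex_eq_iff)
    finally show "(\<integral>x. e x u * K u \<partial>F) = \<Phi> (of_real a * Complex 0 u) * K u"
      by simp
  qed simp
  \<comment> \<open>Second use of the shift, now for s \<mapsto> \<Phi> (a s); the line Re s =
    \<tau> is scaled by a to Re s = t.\<close>
  also have "\<dots> = (\<integral>u. \<Phi> (of_real a * Complex \<tau> u) * of_real (exp (- (u\<^sup>2 / 2))) \<partial>lborel)"
    unfolding K_def
  proof (rule gaussian_line_integral_shift[OF \<tau>(1), where \<Psi> = "\<lambda>s. \<Phi> (of_real a * s)" and A = A and B = "B * a\<^sup>2"])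
    show "continuous_on {s. 0 \<le> Re s} (\<lambda>s. \<Phi> (of_real a * s))"
      by (rule continuous_on_compose2[OF cont]) (use a in \<open>auto intro!: continuous_intros\<close>)
    have "\<Phi> \<circ> (\<lambda>s. of_real a * s) holomorphic_on {s. 0 < Re s}"
      by (rule holomorphic_on_compose_gen[OF _ holo]) (use a in \<open>auto intro!: holomorphic_intros\<close>)
    then show "(\<lambda>s. \<Phi> (of_real a * s)) holomorphic_on {s. 0 < Re s}"
      by (simp add: comp_def)
    show "norm (\<Phi> (of_real a * s)) \<le> exp (A + B * a\<^sup>2 * (norm s)\<^sup>2)" if "0 \<le> Re s" for s
      using bound[of "of_real a * s"] that a by (simp add: norm_mult power_mult_distrib mult_ac)
  qed (use B in auto)
  also have "\<dots> = (\<integral>u. of_real (sqrt (2 * pi)) * (of_real (std_normal_density u) * \<Phi> (Complex t (a * u))) \<partial>lborel)"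
  proof (rule Bochner_Integration.integral_cong)
    fix u
    have "of_real a * Complex \<tau> u = Complex t (a * u)"
      by (simp add: complex_eq_iff \<tau>)
    moreover have "exp (- (u\<^sup>2 / 2)) = sqrt (2 * pi) * std_normal_density u"
      by (simp add: std_normal_density_def)
    ultimately show "\<Phi> (of_real a * Complex \<tau> u) * of_real (exp (- (u\<^sup>2 / 2)))
        = of_real (sqrt (2 * pi)) * (of_real (std_normal_density u) * \<Phi> (Complex t (a * u)))"
      by simp
  qed simp
  also have "\<dots> = of_real (sqrt (2 * pi)) * (\<integral>u. of_real (std_normal_density u) * \<Phi> (Complex t (a * u)) \<partial>lborel)"
    by (rule integral_mult_right_zero)
  finally have "of_real (sqrt (2 * pi)) * complex_of_real (\<integral>x. exp (- t * x - (a * x)\<^sup>2 / 2) \<partial>F)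
      = of_real (sqrt (2 * pi)) * (\<integral>u. of_real (std_normal_density u) * \<Phi> (Complex t (a * u)) \<partial>lborel)"
    unfolding inner_u by (simp del: real_sqrt_mult)
  then show "complex_of_real (\<integral>x. exp (- t * x - (a * x)\<^sup>2 / 2) \<partial>F)
      = (\<integral>u. of_real (std_normal_density u) * \<Phi> (Complex t (a * u)) \<partial>lborel)"
    by simp
qed

text \<open>Both sides of the regularized identity converge as the damping is removed. On the
  Gaussian side domination is available; on the side of \<open>F\<close> monotone convergence is
  used, because integrability of exp (- t x) is itself part of the claim.\<close>

theorem laplace_transform_of_char_extension:
  fixes \<Phi> :: "complex \<Rightarrow> complex" and F :: "real measure" and A B t :: real
  assumes F: "real_distribution F"
    and cont: "continuous_on {s. 0 \<le> Re s} \<Phi>"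
    and holo: "\<Phi> holomorphic_on {s. 0 < Re s}"
    and bound: "\<And>s. 0 \<le> Re s \<Longrightarrow> norm (\<Phi> s) \<le> exp (A + B * (norm s)\<^sup>2)"
    and B: "0 \<le> B"
    and char_F: "\<And>u. char F u = \<Phi> (Complex 0 (- u))"
    and t: "0 \<le> t"
  shows "integrable F (\<lambda>x. exp (- t * x))"
    and "complex_of_real (\<integral>x. exp (- t * x) \<partial>F) = \<Phi> (of_real t)"
proof -
  interpret F: real_distribution F by (rule F)
  \<comment> \<open>The first factor gives B a^2 \<le> B / (4 (1 + B)^2) \<le> 1/4; the second makes
    the sequence decrease to 0.\<close>
  define a where "a n = 1 / (2 * (1 + B)) / real (Suc n)" for n
  have a_pos: "0 < a n" for n
    using B by (simp add: a_def)
  have a_le: "a n \<le> 1 / (2 * (1 + B))" for n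
    using B by (simp add: a_def divide_simps)
  have B_a: "B * (a n)\<^sup>2 \<le> 1 / 4" for n
  proof -
    have "B * (a n)\<^sup>2 \<le> B * (1 / (2 * (1 + B)))\<^sup>2"
      using B a_le[of n] a_pos[of n] by (intro mult_left_mono power_mono) auto
    also have "\<dots> \<le> 1 / 4"
    proof -
      have "B * 4 \<le> (2 + 2 * B)\<^sup>2"
        using B by (simp add: power2_eq_square algebra_simps)
      then show ?thesis using B by (simp add: power_divide divide_simps)
    qed
    finally show ?thesis .
  qed
  have a_lim: "a \<longlonglongrightarrow> 0"
    unfolding a_def by real_asymp
  define L where "L n = (\<integral>x. exp (- t * x - (a n * x)\<^sup>2 / 2) \<partial>F)" for n
  note reg = gaussian_regularized_laplace[OF F cont holo bound char_F t a_pos B B_a]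

  have "(\<lambda>n. \<integral>u. of_real (std_normal_density u) * \<Phi> (Complex t (a n * u)) \<partial>lborel)
      \<longlonglongrightarrow> (\<integral>u. of_real (std_normal_density u) * \<Phi> (of_real t) \<partial>lborel)"
  \<comment> \<open>The density is at most exp (- u^2 / 2), and by the choice of \<open>a\<close>
    the transform grows at most like exp (A + B t^2 + u^2 / 4), uniformly in n.\<close>
  proof (rule integral_dominated_convergence[where w = "\<lambda>u. exp (A + B * t\<^sup>2) * exp (- (u\<^sup>2 * (1 / 4)))"])
    show "(\<lambda>u. of_real (std_normal_density u) * \<Phi> (of_real t)) \<in> borel_measurable lborel"
      by simp
    have cont_n: "continuous_on UNIV (\<lambda>u. \<Phi> (Complex t (c * u)))" for c
      by (rule continuous_on_compose2[OF cont])
         (use t in \<open>auto simp: Complex_eq intro!: continuous_intros\<close>)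
    then have [measurable]: "(\<lambda>u. \<Phi> (Complex t (c * u))) \<in> borel_measurable borel" for c
      by (rule borel_measurable_continuous_onI)
    show "(\<lambda>u. of_real (std_normal_density u) * \<Phi> (Complex t (a n * u))) \<in> borel_measurable lborel" for n
      by simp
    show "integrable lborel (\<lambda>u. exp (A + B * t\<^sup>2) * exp (- (u\<^sup>2 * (1 / 4))))"
      by (intro integrable_mult_right integrable_exp_neg_square) simp
    show "AE u in lborel. (\<lambda>n. of_real (std_normal_density u) * \<Phi> (Complex t (a n * u)))
            \<longlonglongrightarrow> of_real (std_normal_density u) * \<Phi> (of_real t)"
    proof (intro AE_I2 tendsto_mult tendsto_const)
      fix u :: real
      have "(\<lambda>n. Complex t (a n * u)) \<longlonglongrightarrow> Complex t (0 * u)"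
        by (intro tendsto_Complex tendsto_const tendsto_mult a_lim)
      then have "(\<lambda>n. \<Phi> (Complex t (a n * u))) \<longlonglongrightarrow> \<Phi> (Complex t (0 * u))"
        by (rule continuous_on_tendsto_compose[OF cont]) (use t in auto)
      then show "(\<lambda>n. \<Phi> (Complex t (a n * u))) \<longlonglongrightarrow> \<Phi> (of_real t)"
        by (simp add: complex_of_real_def)
    qed
    show "AE u in lborel. norm (of_real (std_normal_density u) * \<Phi> (Complex t (a n * u)))
            \<le> exp (A + B * t\<^sup>2) * exp (- (u\<^sup>2 * (1 / 4)))" for n
    proof (intro AE_I2)
      fix u :: real
      have "1 \<le> 2 * pi" using pi_ge_two by simp
      then have "std_normal_density u \<le> exp (- (u\<^sup>2 / 2))"
        by (simp add: std_normal_density_def divide_simps)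
      moreover have "norm (\<Phi> (Complex t (a n * u))) \<le> exp (A + B * t\<^sup>2 + u\<^sup>2 / 4)"
      proof -
        have "B * (a n)\<^sup>2 * u\<^sup>2 \<le> 1 / 4 * u\<^sup>2"
          by (intro mult_right_mono B_a) simp
        then have "A + B * (norm (Complex t (a n * u)))\<^sup>2 \<le> A + B * t\<^sup>2 + u\<^sup>2 / 4"
          by (simp add: cmod_power2 algebra_simps power_mult_distrib)
        moreover have "norm (\<Phi> (Complex t (a n * u))) \<le> exp (A + B * (norm (Complex t (a n * u)))\<^sup>2)"
          using t by (intro bound) simp
        ultimately show ?thesis
          by (meson exp_le_cancel_iff order_trans)
      qed
      ultimately have "norm (of_real (std_normal_density u) * \<Phi> (Complex t (a n * u)))
          \<le> exp (- (u\<^sup>2 / 2)) * exp (A + B * t\<^sup>2 + u\<^sup>2 / 4)"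
        unfolding norm_mult norm_of_real
        by (intro mult_mono) (auto simp: normal_density_nonneg)
      also have "\<dots> = exp (A + B * t\<^sup>2) * exp (- (u\<^sup>2 * (1 / 4)))"
        unfolding exp_add[symmetric] by (rule arg_cong[where f = exp]) (simp add: field_simps)
      finally show "norm (of_real (std_normal_density u) * \<Phi> (Complex t (a n * u)))
            \<le> exp (A + B * t\<^sup>2) * exp (- (u\<^sup>2 * (1 / 4)))" .
    qed
  qed
  also have "(\<lambda>n. \<integral>u. of_real (std_normal_density u) * \<Phi> (Complex t (a n * u)) \<partial>lborel)
      = (\<lambda>n. complex_of_real (L n))"
    unfolding L_def using reg(2) by simp
  also have "(\<integral>u. of_real (std_normal_density u) * \<Phi> (of_real t) \<partial>lborel) = \<Phi> (of_real t)"
    by simp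
  finally have lim: "(\<lambda>n. complex_of_real (L n)) \<longlonglongrightarrow> \<Phi> (of_real t)" .
  \<comment> \<open>\<open>\<Phi> (of_real t)\<close> is a limit of real numbers and hence real, so
    that monotone convergence over the reals determines it completely.\<close>
  then have lim_Re: "L \<longlonglongrightarrow> Re (\<Phi> (of_real t))"
    using tendsto_Re by fastforce
  have "(\<lambda>n. complex_of_real (L n)) \<longlonglongrightarrow> of_real (Re (\<Phi> (of_real t)))"
    by (intro tendsto_of_real lim_Re)
  with lim have real: "\<Phi> (of_real t) = of_real (Re (\<Phi> (of_real t)))"
    using LIMSEQ_unique by blast

  \<comment> \<open>Since \<open>a n\<close> decreases, the damping weakens and the integrands
    increase.\<close>
  have mono: "AE x in F. mono (\<lambda>n. exp (- t * x - (a n * x)\<^sup>2 / 2))"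
  proof (intro AE_I2 monoI)
    fix x :: real and m n :: nat
    assume "m \<le> n"
    then have "a n \<le> a m"
      using B by (simp add: a_def frac_le)
    then have "(a n)\<^sup>2 * x\<^sup>2 \<le> (a m)\<^sup>2 * x\<^sup>2"
      using a_pos[of n] by (intro mult_right_mono power_mono) auto
    then show "exp (- t * x - (a m * x)\<^sup>2 / 2) \<le> exp (- t * x - (a n * x)\<^sup>2 / 2)"
      by (simp add: power_mult_distrib)
  qed
  have ptw: "AE x in F. (\<lambda>n. exp (- t * x - (a n * x)\<^sup>2 / 2)) \<longlonglongrightarrow> exp (- t * x)"
    by (intro AE_I2) (auto intro!: tendsto_eq_intros a_lim)
  have meas: "(\<lambda>x. exp (- t * x)) \<in> borel_measurable F"
    by simp
  show "integrable F (\<lambda>x. exp (- t * x))"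
    by (rule integrable_monotone_convergence[OF reg(1) mono ptw lim_Re[unfolded L_def] meas])
  have "(\<integral>x. exp (- t * x) \<partial>F) = Re (\<Phi> (of_real t))"
    by (rule integral_monotone_convergence[OF reg(1) mono ptw lim_Re[unfolded L_def] meas])
  then show "complex_of_real (\<integral>x. exp (- t * x) \<partial>F) = \<Phi> (of_real t)"
    using real by simp
qed

section \<open>The transform of extreme stable laws\<close>

text \<open>The parameter \<open>\<kappa>\<close> stands for sec (pi \<alpha> / 2) \<sigma>^\<alpha>
  if \<alpha> \<noteq> 1 and for 2 \<sigma> / pi if \<alpha> = 1, whence the different signs in
  front of it. Principal branches are used, whose cut avoids the open right half-plane.\<close>

definition extreme_stable_laplace :: "real \<Rightarrow> real \<Rightarrow> real \<Rightarrow> complex \<Rightarrow> complex" where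
  "extreme_stable_laplace \<alpha> \<kappa> \<delta> s =
     (if \<alpha> \<noteq> 1 then exp (- s * of_real \<delta> - of_real \<kappa> * s powr of_real \<alpha>)
      else exp (- s * of_real \<delta> + of_real \<kappa> * (s * Ln s)))"

lemma norm_times_Ln_le: "norm (s * Ln s) \<le> norm s * (\<bar>ln (norm s)\<bar> + pi)"
proof (cases "s = 0")
  case False
  have "norm (Ln s) \<le> \<bar>Re (Ln s)\<bar> + \<bar>Im (Ln s)\<bar>"
    by (rule cmod_le)
  also have "\<dots> \<le> \<bar>ln (norm s)\<bar> + pi"
    using False mpi_less_Im_Ln[of s] Im_Ln_le_pi[of s] by auto
  finally show ?thesis
    by (simp add: norm_mult mult_left_mono)
qed simp

text \<open>Away from 0 the closed right half-plane misses the branch cut; at 0 the bound r (|ln r|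
  + pi) with r = |s| tends to 0.\<close>

lemma continuous_on_times_Ln: "continuous_on {s. 0 \<le> Re s} (\<lambda>s. s * Ln s)"
proof -
  have "isCont (\<lambda>s. s * Ln s) s" if "0 \<le> Re s" for s :: complex
  proof (cases "s = 0")
    case True
    have "((\<lambda>r. r * (\<bar>ln r\<bar> + pi)) \<longlongrightarrow> 0) (at_right (0::real))"
      by real_asymp
    moreover have "filterlim norm (at_right 0) (at (0::complex))"
      unfolding filterlim_at
      by (simp add: eventually_at_filter tendsto_norm_zero[OF tendsto_ident_at])
    ultimately have "((\<lambda>s::complex. norm s * (\<bar>ln (norm s)\<bar> + pi)) \<longlongrightarrow> 0) (at 0)"
      by (rule filterlim_compose)
    then have "((\<lambda>s. s * Ln s) \<longlongrightarrow> 0) (at 0)"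
      by (rule Lim_null_comparison[rotated]) (simp add: norm_times_Ln_le)
    with True show ?thesis by (simp add: isCont_def)
  next
    case False
    with that have "s \<notin> \<real>\<^sub>\<le>\<^sub>0"
      by (auto simp: complex_nonpos_Reals_iff complex_eq_iff)
    then show ?thesis by (intro continuous_intros)
  qed
  then show ?thesis
    by (simp add: continuous_at_imp_continuous_on)
qed

lemma continuous_on_extreme_stable_laplace:
  assumes "0 < \<alpha>"
  shows "continuous_on {s. 0 \<le> Re s} (extreme_stable_laplace \<alpha> \<kappa> \<delta>)"
proof (cases "\<alpha> = 1")
  case True
  then show ?thesis
    by (auto simp: extreme_stable_laplace_def intro!: continuous_intros continuous_on_times_Ln)
next
  case False
  with assms show ?thesis
    unfolding extreme_stable_laplace_def by (auto intro!: continuous_intros)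
qed

lemma holomorphic_on_extreme_stable_laplace:
  "extreme_stable_laplace \<alpha> \<kappa> \<delta> holomorphic_on {s. 0 < Re s}"
  unfolding extreme_stable_laplace_def
  by (cases "\<alpha> = 1") (auto intro!: holomorphic_intros simp: complex_nonpos_Reals_iff)

text \<open>Since \<alpha> \<le> 2, every term of the exponent is at most a multiple of 1 + |s|^2.
  The 5 is 1 + 4, from r |ln r| \<le> 1 + r^2 and pi < 4.\<close>

lemma norm_extreme_stable_laplace_le:
  assumes \<alpha>: "0 < \<alpha>" "\<alpha> \<le> 2"
  shows "norm (extreme_stable_laplace \<alpha> \<kappa> \<delta> s)
    \<le> exp ((\<bar>\<delta>\<bar> + 5 * \<bar>\<kappa>\<bar>) + (\<bar>\<delta>\<bar> + 5 * \<bar>\<kappa>\<bar>) * (norm s)\<^sup>2)"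
proof -
  define r where "r = norm s"
  have r: "0 \<le> r" by (simp add: r_def)
  have r_le: "r \<le> 1 + r\<^sup>2"
    using sum_squares_bound[of r 1] r by simp
  define w where "w = (if \<alpha> \<noteq> 1 then - of_real \<kappa> * s powr of_real \<alpha> else of_real \<kappa> * (s * Ln s))"
  have "extreme_stable_laplace \<alpha> \<kappa> \<delta> s = exp (- s * of_real \<delta> + w)"
    by (cases "\<alpha> = 1")
       (simp_all only: extreme_stable_laplace_def w_def simp_thms if_True if_False
          mult_minus_left diff_conv_add_uminus)
  moreover have "norm (- s * of_real \<delta> + w) \<le> \<bar>\<delta>\<bar> * (1 + r\<^sup>2) + \<bar>\<kappa>\<bar> * (5 * (1 + r\<^sup>2))"
  proof (rule norm_triangle_le[OF add_mono])
    show "norm (- s * of_real \<delta>) \<le> \<bar>\<delta>\<bar> * (1 + r\<^sup>2)"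
      using mult_left_mono[OF r_le, of "\<bar>\<delta>\<bar>"] by (simp add: norm_mult mult.commute flip: r_def)
    show "norm w \<le> \<bar>\<kappa>\<bar> * (5 * (1 + r\<^sup>2))"
    proof (cases "\<alpha> = 1")
      case True
      have "r * \<bar>ln r\<bar> \<le> 1 + r\<^sup>2"
      proof (cases "1 \<le> r")
        case True
        then have "r * \<bar>ln r\<bar> \<le> r * r"
          using ln_le_minus_one[of r] by (intro mult_left_mono) auto
        then show ?thesis by (simp add: power2_eq_square)
      next
        case False
        show ?thesis
        proof (cases "r = 0")
          case False
          with \<open>\<not> 1 \<le> r\<close> r have "\<bar>ln r\<bar> \<le> 1 / r"
            using ln_le_minus_one[of "1 / r"] by (simp add: ln_div)
          then have "r * \<bar>ln r\<bar> \<le> r * (1 / r)"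
            using r by (rule mult_left_mono)
          also have "\<dots> \<le> 1 + r\<^sup>2" using False by simp
          finally show ?thesis .
        qed simp
      qed
      moreover have "r * pi \<le> (1 + r\<^sup>2) * 4"
        using r_le r pi_less_4 by (intro mult_mono) auto
      ultimately have "norm (s * Ln s) \<le> 5 * (1 + r\<^sup>2)"
        using norm_times_Ln_le[of s] by (simp add: distrib_left flip: r_def)
      then show ?thesis
        using True by (simp add: w_def norm_mult mult_left_mono)
    next
      case False
      have "r powr \<alpha> \<le> 1 + r\<^sup>2"
      proof (cases "1 \<le> r")
        case True
        then have "r powr \<alpha> \<le> r powr 2" using \<alpha> by (intro powr_mono) auto
        then show ?thesis using True by simp
      next
        case False
        then have "r powr \<alpha> \<le> 1" using r \<alpha> by (intro powr_le1) auto
        then show ?thesis by (simp add: add_increasing2)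
      qed
      then have "r powr \<alpha> \<le> 5 * (1 + r\<^sup>2)"
        using zero_le_power2[of r] unfolding distrib_left by linarith
      then have "\<bar>\<kappa>\<bar> * r powr \<alpha> \<le> \<bar>\<kappa>\<bar> * (5 * (1 + r\<^sup>2))"
        by (rule mult_left_mono) simp
      then show ?thesis
        using False by (simp add: w_def norm_mult norm_powr_real_powr' flip: r_def)
    qed
  qed
  ultimately have "norm (extreme_stable_laplace \<alpha> \<kappa> \<delta> s)
      \<le> exp (\<bar>\<delta>\<bar> * (1 + r\<^sup>2) + \<bar>\<kappa>\<bar> * (5 * (1 + r\<^sup>2)))"
    using norm_exp order_trans by fastforce
  also have "\<dots> = exp ((\<bar>\<delta>\<bar> + 5 * \<bar>\<kappa>\<bar>) + (\<bar>\<delta>\<bar> + 5 * \<bar>\<kappa>\<bar>) * (norm s)\<^sup>2)"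
    unfolding r_def by (simp add: algebra_simps)
  finally show ?thesis .
qed

section \<open>Boundary values on the imaginary axis\<close>

lemma cos_half_pi_times_pos: "0 < \<alpha> \<Longrightarrow> \<alpha> < 1 \<Longrightarrow> 0 < cos (pi * \<alpha> / 2)"
  by (rule cos_gt_zero) auto

lemma cos_half_pi_times_neg:
  assumes "1 < \<alpha>" "\<alpha> \<le> 2"
  shows "cos (pi * \<alpha> / 2) < 0"
proof -
  have "pi * 1 < pi * \<alpha>" "pi * \<alpha> \<le> pi * 2"
    using assms by (intro mult_strict_left_mono mult_left_mono; simp)+
  then have "0 < cos (pi - pi * \<alpha> / 2)"
    using pi_gt_zero by (intro cos_gt_zero_pi) linarith+
  then show ?thesis by simp
qed

text \<open>The characteristic function at u is the transform at - i u, hence the sign. That point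
  is |u| times - i or i, with principal argument - sgn u * pi / 2.\<close>

lemma Ln_imaginary_axis:
  assumes "u \<noteq> 0"
  shows "Ln (Complex 0 (- u)) = of_real (ln \<bar>u\<bar>) - \<i> * of_real (sgn u * (pi / 2))"
proof (cases "0 < u")
  case True
  have "Complex 0 (- u) = of_real u * (- \<i>)"
    by (simp add: complex_eq_iff)
  with True show ?thesis
    by (simp only:, subst Ln_times_of_real) (simp_all add: Ln_of_real)
next
  case False
  have "Complex 0 (- u) = of_real (- u) * \<i>"
    by (simp add: complex_eq_iff)
  with False assms show ?thesis
    by (simp only:, subst Ln_times_of_real) (simp_all add: Ln_of_real[of "- u", simplified])
qed

text \<open>For \<alpha> \<noteq> 1 and \<theta> = pi \<alpha> / 2, the power (- i u)^\<alpha> is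
  |u|^\<alpha> cos \<theta> (1 - i sgn u tan \<theta>), and the secant in \<open>\<kappa>\<close>
  cancels the cosine. For \<alpha> = 1 the angle pi / 2 in the logarithm cancels the 2 / pi in
  \<open>\<kappa>\<close> and yields the term - \<sigma> |u|.\<close>

lemma stable_char_eq_extreme_stable_laplace:
  assumes \<alpha>: "0 < \<alpha>" "\<alpha> \<le> 2"
    and \<kappa>: "\<kappa> = (if \<alpha> \<noteq> 1 then sec (pi * \<alpha> / 2) * \<sigma> powr \<alpha> else \<sigma> * (2 / pi))"
  shows "stable_char \<alpha> \<sigma> 1 \<delta> u = extreme_stable_laplace \<alpha> \<kappa> \<delta> (Complex 0 (- u))"
proof (cases "u = 0")
  case True
  have "Complex 0 0 = 0" by (simp add: complex_eq_iff)
  then show ?thesis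
    using True by (simp add: stable_char_def extreme_stable_laplace_def)
next
  case u: False
  have nz: "Complex 0 (- u) \<noteq> 0"
    using u by (simp add: complex_eq_iff)
  have iu: "Complex 0 (- u) = - (\<i> * of_real u)"
    by (simp add: complex_eq_iff)
  show ?thesis
  proof (cases "\<alpha> = 1")
    case True
    have *: "Complex 0 (- u) * Ln (Complex 0 (- u))
        = - (of_real (\<bar>u\<bar> * (pi / 2))) - \<i> * of_real (u * ln \<bar>u\<bar>)"
      unfolding Ln_imaginary_axis[OF u] by (simp add: complex_eq_iff abs_sgn)
    have "of_real \<kappa> * (Complex 0 (- u) * Ln (Complex 0 (- u)))
        = - of_real (\<sigma> * \<bar>u\<bar>) * (1 + \<i> * of_real (1 * (2 / pi) * sgn u * ln \<bar>u\<bar>))"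
      unfolding * using True u by (cases "0 < u") (simp_all add: complex_eq_iff \<kappa>)
    then show ?thesis
      using True by (simp add: stable_char_def extreme_stable_laplace_def iu mult.assoc)
  next
    case False
    define \<theta> where "\<theta> = pi * \<alpha> / 2"
    have cos: "cos \<theta> \<noteq> 0"
      using cos_half_pi_times_pos[of \<alpha>] cos_half_pi_times_neg[of \<alpha>] \<alpha> False
      by (cases "\<alpha> < 1") (auto simp: \<theta>_def)
    have "Complex 0 (- u) powr of_real \<alpha> = exp (of_real (\<alpha> * ln \<bar>u\<bar>) + \<i> * of_real (- (sgn u * \<theta>)))"
      using nz by (simp add: powr_def Ln_imaginary_axis[OF u] \<theta>_def algebra_simps)
    also have "\<dots> = of_real (\<bar>u\<bar> powr \<alpha>) * cis (- (sgn u * \<theta>))"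
    proof -
      have "\<bar>u\<bar> powr \<alpha> = exp (\<alpha> * ln \<bar>u\<bar>)"
        using u by (simp add: powr_def)
      then show ?thesis
        by (simp only: exp_add exp_of_real cis_conv_exp)
    qed
    also have "cis (- (sgn u * \<theta>)) = of_real (cos \<theta>) * (1 - \<i> * of_real (1 * sgn u * tan \<theta>))"
      using u cos by (cases "0 < u") (auto simp: complex_eq_iff tan_def)
    finally have "of_real \<kappa> * Complex 0 (- u) powr of_real \<alpha>
        = of_real ((\<kappa> * cos \<theta>) * \<bar>u\<bar> powr \<alpha>) * (1 - \<i> * of_real (1 * sgn u * tan \<theta>))"
      by (simp only: of_real_mult mult_ac)
    also have "\<kappa> * cos \<theta> = \<sigma> powr \<alpha>"
      using False cos by (simp add: \<kappa> sec_def flip: \<theta>_def)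
    finally have "of_real \<kappa> * Complex 0 (- u) powr of_real \<alpha>
        = of_real (\<sigma> powr \<alpha> * \<bar>u\<bar> powr \<alpha>) * (1 - \<i> * of_real (1 * sgn u * tan \<theta>))" .
    then show ?thesis
      using False by (simp add: stable_char_def extreme_stable_laplace_def iu \<theta>_def mult_ac)
  qed
qed

section \<open>Mixed Poisson weights and the sign of their coefficients\<close>

lemma power_le_fact_times_exp:
  fixes y :: real
  assumes "0 \<le> y"
  shows "y ^ n \<le> fact n * exp y"
proof -
  have "y ^ n / fact n \<le> (\<Sum>k. y ^ k / fact k)"
    using sum_le_suminf[OF summable_exp_generic[of y], of "{n}"] assms
    by (simp add: scaleR_conv_of_real divide_inverse mult.commute)
  also have "\<dots> = exp y"
    by (simp add: exp_def scaleR_conv_of_real divide_inverse mult.commute)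
  finally show ?thesis by (simp add: divide_simps mult.commute)
qed

text \<open>For negative x the exponent |x| - x is - 2 x. Finiteness of the transform at 2 therefore
  supplies one dominating function for all weights and all partial sums below.\<close>

lemma exp_abs_minus_le:
  fixes x z :: real
  assumes "\<bar>z\<bar> \<le> 1"
  shows "exp (\<bar>z * x\<bar> - x) \<le> 1 + exp (- 2 * x)"
proof -
  have "\<bar>z * x\<bar> \<le> \<bar>x\<bar>"
    using mult_right_mono[OF assms, of "\<bar>x\<bar>"] by (simp add: abs_mult)
  then have "exp (\<bar>z * x\<bar> - x) \<le> exp (\<bar>x\<bar> - x)" by simp
  also have "\<dots> \<le> 1 + exp (- 2 * x)"
    by (cases "0 \<le> x") auto
  finally show ?thesis .
qed

lemma integrable_power_times_exp:
  assumes "real_distribution F" and "integrable F (\<lambda>x. exp (- 2 * x))"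
  shows "integrable F (\<lambda>x. x ^ n * exp (- x))"
proof -
  interpret F: real_distribution F by fact
  have "integrable F (\<lambda>x. fact n * (1 + exp (- 2 * x)))"
    using assms by (intro integrable_mult_right Bochner_Integration.integrable_add) auto
  then show ?thesis
  proof (rule Bochner_Integration.integrable_bound)
    show "AE x in F. norm (x ^ n * exp (- x)) \<le> norm (fact n * (1 + exp (- 2 * x)))"
    proof (intro AE_I2)
      fix x :: real
      have "norm (x ^ n * exp (- x)) = \<bar>x\<bar> ^ n * exp (- x)"
        by (simp add: abs_mult power_abs)
      also have "\<dots> \<le> fact n * exp \<bar>x\<bar> * exp (- x)"
        by (intro mult_right_mono power_le_fact_times_exp) auto
      also have "\<dots> = fact n * exp (\<bar>1 * x\<bar> - x)"
        by (simp add: exp_diff exp_minus field_simps)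
      also have "\<dots> \<le> fact n * (1 + exp (- 2 * x))"
        by (intro mult_left_mono exp_abs_minus_le) auto
      also have "\<dots> \<le> norm (fact n * (1 + exp (- 2 * x)))" by simp
      finally show "norm (x ^ n * exp (- x)) \<le> norm (fact n * (1 + exp (- 2 * x)))" .
    qed
  qed simp
qed

text \<open>The factor exp (z x) in exp (- (1 - z) x) is expanded, and the partial sums are
  dominated by exp (|z x| - x). The endpoint z = 1 is included because it gives the total
  mass.\<close>

lemma mixed_poisson_fun_sums:
  assumes "real_distribution F" and "integrable F (\<lambda>x. exp (- 2 * x))" and z: "\<bar>z\<bar> \<le> 1"
  shows "(\<lambda>n. mixed_poisson_fun F n * z ^ n) sums bilateral_laplace F (1 - z)"
proof -
  interpret F: real_distribution F by fact
  define s where "s N x = (\<Sum>n<N. (z * x) ^ n / fact n) * exp (- x)" for N and x :: real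
  have "(\<lambda>N. \<integral>x. s N x \<partial>F) \<longlonglongrightarrow> (\<integral>x. exp (- (1 - z) * x) \<partial>F)"
  proof (rule integral_dominated_convergence[where w = "\<lambda>x. 1 + exp (- 2 * x)"])
    show "integrable F (\<lambda>x. 1 + exp (- 2 * x))"
      using assms by (intro Bochner_Integration.integrable_add) auto
    show "AE x in F. (\<lambda>N. s N x) \<longlonglongrightarrow> exp (- (1 - z) * x)"
    proof (intro AE_I2)
      fix x :: real
      have "(\<lambda>n. (z * x) ^ n / fact n) sums exp (z * x)"
        using exp_converges[of "z * x"] by (simp add: divide_inverse mult.commute)
      then have "(\<lambda>N. s N x) \<longlonglongrightarrow> exp (z * x) * exp (- x)"
        unfolding s_def sums_def by (intro tendsto_mult tendsto_const)
      also have "exp (z * x) * exp (- x) = exp (- (1 - z) * x)"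
        by (simp add: algebra_simps flip: exp_add)
      finally show "(\<lambda>N. s N x) \<longlonglongrightarrow> exp (- (1 - z) * x)" .
    qed
    show "AE x in F. norm (s N x) \<le> 1 + exp (- 2 * x)" for N
    proof (intro AE_I2)
      fix x :: real
      have "norm (s N x) \<le> (\<Sum>n<N. \<bar>z * x\<bar> ^ n / fact n) * exp (- x)"
        unfolding s_def norm_mult
        by (intro mult_mono order_trans[OF norm_sum] sum_mono) (auto simp: power_abs sum_nonneg abs_mult)
      also have "\<dots> \<le> exp \<bar>z * x\<bar> * exp (- x)"
      proof (intro mult_right_mono)
        have "(\<lambda>n. \<bar>z * x\<bar> ^ n / fact n) sums exp \<bar>z * x\<bar>"
          using exp_converges[of "\<bar>z * x\<bar>"] by (simp add: divide_inverse mult.commute)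
        then show "(\<Sum>n<N. \<bar>z * x\<bar> ^ n / fact n) \<le> exp \<bar>z * x\<bar>"
          using sum_le_suminf[of "\<lambda>n. \<bar>z * x\<bar> ^ n / fact n" "{..<N}"] by (simp add: sums_iff)
      qed simp
      also have "\<dots> = exp (\<bar>z * x\<bar> - x)" by (simp flip: exp_add)
      also have "\<dots> \<le> 1 + exp (- 2 * x)" by (rule exp_abs_minus_le[OF z])
      finally show "norm (s N x) \<le> 1 + exp (- 2 * x)" .
    qed
  qed (simp_all add: s_def)
  moreover have "(\<integral>x. s N x \<partial>F) = (\<Sum>n<N. mixed_poisson_fun F n * z ^ n)" for N
  proof -
    have "s N x = (\<Sum>n<N. z ^ n / fact n * (x ^ n * exp (- x)))" for x
      by (simp add: s_def sum_distrib_right power_mult_distrib mult.assoc)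
    then have "(\<integral>x. s N x \<partial>F) = (\<Sum>n<N. z ^ n / fact n * (\<integral>x. x ^ n * exp (- x) \<partial>F))"
      using integrable_power_times_exp[OF assms(1,2)]
      by (simp add: Bochner_Integration.integral_sum)
    then show ?thesis by (simp add: mixed_poisson_fun_def mult_ac)
  qed
  ultimately show ?thesis
    by (simp add: sums_def bilateral_laplace_def)
qed

section \<open>Nonnegative coefficients from the logarithmic derivative\<close>

lemma power_series_zero_imp_coeffs_zero:
  fixes c :: "nat \<Rightarrow> real"
  assumes "0 < r" and "\<And>z. \<bar>z\<bar> < r \<Longrightarrow> (\<lambda>n. c n * z ^ n) sums 0"
  shows "c n = 0"
proof (cases "n = 0")
  case True
  then show ?thesis using assms(2)[of 0] assms(1) by simp
next
  case False
  show ?thesis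
  proof (rule ccontr)
    assume "c n \<noteq> 0"
    \<comment> \<open>Isolation of zeros of a nontrivial power series, applied to the zero
      function.\<close>
    then obtain s where s: "0 < s" "\<And>z::real. z \<in> cball 0 s - {0} \<Longrightarrow> (0::real) \<noteq> 0"
      using powser_0_nonzero[of r 0 c "\<lambda>_. 0" n] assms False by auto
    from s(2)[of s] s(1) show False by simp
  qed
qed

text \<open>Comparing coefficients in G' = q G gives (n + 1) f (n + 1) = sum of p i * f (n - i) over
  i \<le> n, so nonnegativity propagates from \<open>f 0\<close> by strong induction.\<close>

lemma coeffs_nonneg_of_log_derivative:
  fixes f p :: "nat \<Rightarrow> real" and G q :: "real \<Rightarrow> real"
  assumes f: "\<And>z. \<bar>z\<bar> < 1 \<Longrightarrow> (\<lambda>n. f n * z ^ n) sums G z"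
    and p: "\<And>z. \<bar>z\<bar> < 1 \<Longrightarrow> (\<lambda>n. p n * z ^ n) sums q z"
    and G: "\<And>z. \<bar>z\<bar> < 1 \<Longrightarrow> (G has_real_derivative q z * G z) (at z)"
    and f0: "0 \<le> f 0" and p_nonneg: "\<And>n. 0 \<le> p n"
  shows "0 \<le> f n"
proof -
  \<comment> \<open>\<open>d n\<close> is the n-th coefficient of G' - q G, with G' taken termwise
    and q G as a Cauchy product.\<close>
  define d where "d n = diffs f n - (\<Sum>i\<le>n. p i * f (n - i))" for n
  have "(\<lambda>n. d n * z ^ n) sums 0" if z: "\<bar>z\<bar> < 1" for z
  proof -
    \<comment> \<open>The Cauchy product requires absolute convergence, which follows from
      convergence at a point between |z| and 1.\<close>
    have abs_summable: "summable (\<lambda>n. norm (c n * z ^ n))"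
      if c: "\<And>z. \<bar>z\<bar> < 1 \<Longrightarrow> (\<lambda>n. c n * z ^ n) sums h z" for c :: "nat \<Rightarrow> real" and h
    proof -
      obtain w where w: "\<bar>z\<bar> < w" "w < 1" using z dense by blast
      then show ?thesis
        using powser_insidea[of c w z] sums_summable[OF c[of w]] by simp
    qed
    have "(\<lambda>n. \<Sum>i\<le>n. (p i * z ^ i) * (f (n - i) * z ^ (n - i))) sums (q z * G z)"
      using Cauchy_product_sums[OF abs_summable[OF p] abs_summable[OF f]]
        sums_unique[OF p[OF z]] sums_unique[OF f[OF z]] by simp
    moreover have "(\<Sum>i\<le>n. (p i * z ^ i) * (f (n - i) * z ^ (n - i))) = (\<Sum>i\<le>n. p i * f (n - i)) * z ^ n" for n
    proof -
      have "(p i * z ^ i) * (f (n - i) * z ^ (n - i)) = p i * f (n - i) * z ^ n" if "i \<le> n" for i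
      proof -
        have "z ^ n = z ^ i * z ^ (n - i)"
          using that by (simp flip: power_add)
        then show ?thesis by (simp only: mult_ac)
      qed
      then show ?thesis
        unfolding sum_distrib_right by (intro sum.cong) auto
    qed
    ultimately have "(\<lambda>n. (\<Sum>i\<le>n. p i * f (n - i)) * z ^ n) sums (q z * G z)"
      by simp
    moreover have "(\<lambda>n. diffs f n * z ^ n) sums (q z * G z)"
      by (rule termdiffs_sums_strong[where K = 1 and f = G]) (use f G z in auto)
    ultimately have "(\<lambda>n. diffs f n * z ^ n - (\<Sum>i\<le>n. p i * f (n - i)) * z ^ n) sums (q z * G z - q z * G z)"
      by (intro sums_diff)
    then show ?thesis by (simp add: d_def left_diff_distrib)
  qed
  then have d0: "d n = 0" for n
    by (rule power_series_zero_imp_coeffs_zero[of 1, rotated]) auto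
  show ?thesis
  proof (induction n rule: less_induct)
    case (less n)
    show ?case
    proof (cases n)
      case (Suc m)
      have "real (Suc m) * f (Suc m) = (\<Sum>i\<le>m. p i * f (m - i))"
        using d0[of m] by (simp add: d_def diffs_def)
      also have "\<dots> \<ge> 0"
        using less Suc p_nonneg by (intro sum_nonneg mult_nonneg_nonneg) auto
      finally show ?thesis using Suc by (simp add: zero_le_mult_iff)
    qed (use f0 in simp)
  qed
qed

text \<open>Rising factorials replace alternating binomial coefficients so that the signs of the
  coefficients of (1 - z)^a can be read off their factors.\<close>

lemma minus_one_power_times_gbinomial:
  "(- 1) ^ n * ((a::real) gchoose n) = pochhammer (- a) n / fact n"
  by (simp add: gbinomial_pochhammer flip: power_mult_distrib mult.assoc)

lemma pochhammer_nonneg_of_nonneg: "0 \<le> (x::real) \<Longrightarrow> 0 \<le> pochhammer x n"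
  by (auto simp: pochhammer_prod intro!: prod_nonneg)

lemma one_minus_powr_sums:
  fixes a z :: real
  assumes "\<bar>z\<bar> < 1"
  shows "(\<lambda>n. pochhammer (- a) n / fact n * z ^ n) sums (1 - z) powr a"
proof -
  have "(\<lambda>n. (a gchoose n) * (- z) ^ n) sums (1 + (- z)) powr a"
    using assms by (intro gen_binomial_real) simp
  moreover have "(a gchoose n) * (- z) ^ n = pochhammer (- a) n / fact n * z ^ n" for n
    by (simp add: power_minus[of z] flip: minus_one_power_times_gbinomial)
  ultimately show ?thesis by simp
qed

text \<open>The logarithmic derivative is \<delta> + \<kappa> \<alpha> (1 - z)^(\<alpha> - 1). Its
  constant coefficient is \<delta> + \<alpha> \<kappa>; the later ones contain the factor \<kappa>
  (1 - \<alpha>) and a rising factorial from 2 - \<alpha> \<ge> 0.\<close>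

lemma coeffs_nonneg_powr:
  fixes f :: "nat \<Rightarrow> real" and \<alpha> \<kappa> \<delta> :: real
  assumes f: "\<And>z. \<bar>z\<bar> < 1 \<Longrightarrow> (\<lambda>n. f n * z ^ n) sums exp ((z - 1) * \<delta> - \<kappa> * (1 - z) powr \<alpha>)"
    and \<alpha>: "0 < \<alpha>" "\<alpha> \<le> 2" and \<kappa>: "0 \<le> \<kappa> * (1 - \<alpha>)" and \<delta>: "- \<alpha> * \<kappa> \<le> \<delta>"
  shows "0 \<le> f n"
proof (rule coeffs_nonneg_of_log_derivative[OF f])
  let ?c = "\<lambda>n. \<kappa> * \<alpha> * (pochhammer (1 - \<alpha>) n / fact n)"
  let ?p = "\<lambda>n. \<delta> * (if n = 0 then 1 else 0) + ?c n"
  let ?q = "\<lambda>z. \<delta> + \<kappa> * \<alpha> * (1 - z) powr (\<alpha> - 1)"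
  fix z :: real assume z: "\<bar>z\<bar> < 1"
  have "(\<lambda>n. \<delta> * ((if n = 0 then 1 else 0) * z ^ n)) sums \<delta>"
    using sums_mult[OF powser_sums_if[of 0 z], of \<delta>] by (simp only: power_0 mult_1_right)
  moreover have "(\<lambda>n. \<kappa> * \<alpha> * (pochhammer (1 - \<alpha>) n / fact n * z ^ n)) sums (\<kappa> * \<alpha> * (1 - z) powr (\<alpha> - 1))"
    using sums_mult[OF one_minus_powr_sums[OF z, of "\<alpha> - 1"]] by simp
  ultimately have "(\<lambda>n. \<delta> * ((if n = 0 then 1 else 0) * z ^ n) + \<kappa> * \<alpha> * (pochhammer (1 - \<alpha>) n / fact n * z ^ n)) sums ?q z"
    by (rule sums_add)
  then show "(\<lambda>n. ?p n * z ^ n) sums ?q z"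
    by (simp only: distrib_right mult.assoc)
  show "((\<lambda>z. exp ((z - 1) * \<delta> - \<kappa> * (1 - z) powr \<alpha>)) has_real_derivative
          ?q z * exp ((z - 1) * \<delta> - \<kappa> * (1 - z) powr \<alpha>)) (at z)"
    using z by (auto intro!: derivative_eq_intros simp: powr_diff field_simps)
next
  show "0 \<le> f 0"
    using f[of 0] by (simp add: sums_iff flip: exp_zero)
next
  fix n
  show "0 \<le> \<delta> * (if n = 0 then 1 else 0) + \<kappa> * \<alpha> * (pochhammer (1 - \<alpha>) n / fact n)"
  proof (cases n)
    case 0
    then show ?thesis using \<delta> by (simp add: mult.commute)
  next
    case (Suc m)
    have "0 \<le> pochhammer (2 - \<alpha>) m * \<alpha> / fact n"
      using \<alpha> by (intro divide_nonneg_nonneg mult_nonneg_nonneg pochhammer_nonneg_of_nonneg) auto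
    from mult_nonneg_nonneg[OF \<kappa> this]
    have "0 \<le> \<kappa> * (1 - \<alpha>) * (pochhammer (2 - \<alpha>) m * \<alpha> / fact n)" .
    then show ?thesis
      using Suc by (simp add: pochhammer_rec mult_ac)
  qed
qed

text \<open>The logarithmic derivative is \<delta> - \<kappa> - \<kappa> ln (1 - z), with
  coefficients \<delta> - \<kappa> at 0 and \<kappa> / n afterwards.\<close>

lemma coeffs_nonneg_ln:
  fixes f :: "nat \<Rightarrow> real" and \<kappa> \<delta> :: real
  assumes f: "\<And>z. \<bar>z\<bar> < 1 \<Longrightarrow> (\<lambda>n. f n * z ^ n) sums exp ((z - 1) * \<delta> + \<kappa> * (1 - z) * ln (1 - z))"
    and \<kappa>: "0 \<le> \<kappa>" and \<delta>: "\<kappa> \<le> \<delta>"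
  shows "0 \<le> f n"
proof (rule coeffs_nonneg_of_log_derivative[OF f])
  \<comment> \<open>At n = 0 the summand \<open>\<kappa> / real n\<close> is 0 by the convention for
    division by zero.\<close>
  let ?p = "\<lambda>n. (\<delta> - \<kappa>) * (if n = 0 then 1 else 0) + \<kappa> / real n"
  let ?q = "\<lambda>z. (\<delta> - \<kappa>) - \<kappa> * ln (1 - z)"
  fix z :: real assume z: "\<bar>z\<bar> < 1"
  have "(\<lambda>n. (\<delta> - \<kappa>) * ((if n = 0 then 1 else 0) * z ^ n)) sums (\<delta> - \<kappa>)"
    using sums_mult[OF powser_sums_if[of 0 z], of "\<delta> - \<kappa>"] by (simp only: power_0 mult_1_right)
  moreover have "(\<lambda>n. (- \<kappa>) * (- (z ^ n) / real n)) sums ((- \<kappa>) * ln (1 - z))"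
    using ln_series'[of "- z"] z by (intro sums_mult) simp
  ultimately have "(\<lambda>n. (\<delta> - \<kappa>) * ((if n = 0 then 1 else 0) * z ^ n) + (- \<kappa>) * (- (z ^ n) / real n)) sums
      ((\<delta> - \<kappa>) + (- \<kappa>) * ln (1 - z))"
    by (rule sums_add)
  then show "(\<lambda>n. ?p n * z ^ n) sums ?q z"
    by (simp add: distrib_right mult.assoc)
  have "((\<lambda>z. (z - 1) * \<delta> + \<kappa> * (1 - z) * ln (1 - z)) has_real_derivative ?q z) (at z)"
    using z by (auto intro!: derivative_eq_intros)
  from DERIV_fun_exp[OF this]
  show "((\<lambda>z. exp ((z - 1) * \<delta> + \<kappa> * (1 - z) * ln (1 - z))) has_real_derivative
          ?q z * exp ((z - 1) * \<delta> + \<kappa> * (1 - z) * ln (1 - z))) (at z)"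
    by (simp only: mult.commute)
next
  show "0 \<le> f 0"
    using f[of 0] by (simp add: sums_iff)
next
  show "0 \<le> (\<delta> - \<kappa>) * (if n = 0 then 1 else 0) + \<kappa> / real n" for n
    using \<kappa> \<delta> by simp
qed

section \<open>Generating functions and the final statement\<close>

lemma pgf_sums:
  fixes z :: real
  assumes "\<bar>z\<bar> \<le> 1"
  shows "(\<lambda>n. pmf p n * z ^ n) sums pgf p z"
proof -
  have "integrable (measure_pmf p) (\<lambda>n. z ^ n)"
    using assms by (intro measure_pmf.integrable_const_bound[where B = 1])
      (auto simp: power_abs power_le_one)
  then have "integrable (count_space UNIV) (\<lambda>n. pmf p n * z ^ n)"
    by (subst (asm) measure_pmf_eq_density) (simp add: integrable_density)
  then have "(\<lambda>n. pmf p n * z ^ n) sums (\<integral>n. pmf p n * z ^ n \<partial>count_space UNIV)"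
    by (rule sums_integral_count_space_nat)
  also have "(\<integral>n. pmf p n * z ^ n \<partial>count_space UNIV) = pgf p z"
    by (simp add: pgf_def measure_pmf_eq_density integral_density)
  finally show ?thesis .
qed

theorem theorem4p1:
  fixes \<alpha> \<sigma> \<delta> :: real
    and M :: "'a measure" and X :: "'a \<Rightarrow> real" and F :: "real measure"
  assumes "0 < \<alpha>" and "\<alpha> \<le> 2"
    and "if \<alpha> = 1 then 0 \<le> \<sigma> else 0 < \<sigma>"
    and "prob_space M" and "X \<in> borel_measurable M"
    and "F = distr M borel X"
    and "stable_distribution \<alpha> \<sigma> 1 \<delta> F"
  shows
    "(\<forall>t\<ge>0.
        integrable F (\<lambda>x. exp (- t * x)) \<and>
        bilateral_laplace F t =
          (if \<alpha> \<noteq> 1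
           then exp (- t * \<delta> - sec (pi * \<alpha> / 2) * \<sigma> powr \<alpha> * t powr \<alpha>)
           else exp (- t * \<delta> + \<sigma> * (2 / pi) * t * ln t)))
     \<and>
     (\<delta> \<ge> (if \<alpha> \<noteq> 1
            then - \<alpha> * sec (pi * \<alpha> / 2) * \<sigma> powr \<alpha>
            else \<sigma> * (2 / pi)) \<longrightarrow>
        mixed_poisson_exists F \<and>
        (\<forall>z\<in>{0..1}.
          pgf (mixed_poisson F) z =
            (if \<alpha> \<noteq> 1
             then exp ((z - 1) * \<delta> - sec (pi * \<alpha> / 2) * \<sigma> powr \<alpha> * (1 - z) powr \<alpha>)
             else exp ((z - 1) * \<delta> + \<sigma> * (2 / pi) * (1 - z) * ln (1 - z)))))"
proof -
  define \<kappa> where "\<kappa> = (if \<alpha> \<noteq> 1 then sec (pi * \<alpha> / 2) * \<sigma> powr \<alpha> else \<sigma> * (2 / pi))"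
  define L where "L t = (if \<alpha> \<noteq> 1 then exp (- t * \<delta> - \<kappa> * t powr \<alpha>)
      else exp (- t * \<delta> + \<kappa> * t * ln t))" for t :: real
  note \<alpha> = assms(1,2)
  have F: "real_distribution F" and char_F: "char F u = stable_char \<alpha> \<sigma> 1 \<delta> u" for u
    using assms(7) by (auto simp: stable_distribution_def)
  note char_L = char_F[unfolded stable_char_eq_extreme_stable_laplace[OF \<alpha> \<kappa>_def]]
  have B: "0 \<le> \<bar>\<delta>\<bar> + 5 * \<bar>\<kappa>\<bar>" by simp
  note laplace = laplace_transform_of_char_extension[OF F
      continuous_on_extreme_stable_laplace[OF \<alpha>(1)] holomorphic_on_extreme_stable_laplace
      norm_extreme_stable_laplace_le[OF \<alpha>] B char_L]
  have L_complex: "extreme_stable_laplace \<alpha> \<kappa> \<delta> (of_real t) = of_real (L t)" if "0 \<le> t" for t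
  proof (cases "t = 0")
    case True
    then show ?thesis by (simp add: extreme_stable_laplace_def L_def)
  next
    case False
    with that have "0 < t" by simp
    then show ?thesis
      by (simp add: extreme_stable_laplace_def L_def Ln_of_real powr_of_real mult.assoc flip: exp_of_real)
  qed
  have L: "bilateral_laplace F t = L t" if "0 \<le> t" for t
    using laplace(2)[OF that] L_complex[OF that] by (simp add: bilateral_laplace_def)
  \<comment> \<open>The point 2 is where \<open>exp_abs_minus_le\<close> calls for a finite
    transform.\<close>
  have int2: "integrable F (\<lambda>x. exp (- 2 * x))"
    by (rule laplace(1)) simp
  have sums: "(\<lambda>n. mixed_poisson_fun F n * z ^ n) sums L (1 - z)" if "\<bar>z\<bar> \<le> 1" for z
    using mixed_poisson_fun_sums[OF F int2 that] L[of "1 - z"] that by simp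

  have existence: "mixed_poisson_exists F"
    if \<delta>: "\<delta> \<ge> (if \<alpha> \<noteq> 1 then - \<alpha> * sec (pi * \<alpha> / 2) * \<sigma> powr \<alpha> else \<sigma> * (2 / pi))"
  proof -
    have "0 \<le> mixed_poisson_fun F n" for n
    proof (cases "\<alpha> = 1")
      case True
      show ?thesis
      proof (rule coeffs_nonneg_ln)
        show "(\<lambda>n. mixed_poisson_fun F n * z ^ n) sums exp ((z - 1) * \<delta> + \<kappa> * (1 - z) * ln (1 - z))"
          if "\<bar>z\<bar> < 1" for z
          using sums[of z] that True by (simp add: L_def algebra_simps)
        show "0 \<le> \<kappa>" "\<kappa> \<le> \<delta>"
          using True \<delta> assms(3) by (simp_all add: \<kappa>_def)
      qed
    next
      case False
      show ?thesis
      proof (rule coeffs_nonneg_powr[OF _ \<alpha>])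
        show "(\<lambda>n. mixed_poisson_fun F n * z ^ n) sums exp ((z - 1) * \<delta> - \<kappa> * (1 - z) powr \<alpha>)"
          if "\<bar>z\<bar> < 1" for z
          using sums[of z] that False by (simp add: L_def algebra_simps)
        show "- \<alpha> * \<kappa> \<le> \<delta>"
          using False \<delta> by (simp add: \<kappa>_def mult_ac)
        \<comment> \<open>The secant has the sign of 1 - \<alpha>: the angle pi \<alpha> / 2 passes
          pi / 2 at \<alpha> = 1.\<close>
        have "0 \<le> sec (pi * \<alpha> / 2) * (1 - \<alpha>)"
          using cos_half_pi_times_pos[of \<alpha>] cos_half_pi_times_neg[of \<alpha>] \<alpha> False
          by (cases "\<alpha> < 1") (auto simp: sec_def zero_le_divide_iff)
        then have "0 \<le> sec (pi * \<alpha> / 2) * (1 - \<alpha>) * \<sigma> powr \<alpha>"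
          by (rule mult_nonneg_nonneg) simp
        then show "0 \<le> \<kappa> * (1 - \<alpha>)"
          using False by (simp add: \<kappa>_def mult_ac)
      qed
    qed
    \<comment> \<open>The total mass is the transform at 0, where \<open>0 powr \<alpha> = 0\<close>
      and, for \<alpha> = 1, the factor t = 0 removes the logarithm.\<close>
    moreover have "mixed_poisson_fun F sums 1"
      using sums[of 1] by (simp add: L_def cong: if_cong)
    ultimately show ?thesis
      using integrable_power_times_exp[OF F int2]
      by (auto simp: mixed_poisson_exists_def valid_pmf_def)
  qed
  have pgf: "pgf (mixed_poisson F) z = L (1 - z)" if "mixed_poisson_exists F" "z \<in> {0..1}" for z
  proof (rule sums_unique2)
    show "(\<lambda>n. mixed_poisson_fun F n * z ^ n) sums pgf (mixed_poisson F) z"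
      using pgf_sums[of z "mixed_poisson F"] that by (simp add: pmf_mixed_poisson)
    show "(\<lambda>n. mixed_poisson_fun F n * z ^ n) sums L (1 - z)"
      using that by (intro sums) auto
  qed
  have "L t = (if \<alpha> \<noteq> 1
           then exp (- t * \<delta> - sec (pi * \<alpha> / 2) * \<sigma> powr \<alpha> * t powr \<alpha>)
           else exp (- t * \<delta> + \<sigma> * (2 / pi) * t * ln t))" for t
    by (simp add: L_def \<kappa>_def)
  moreover have "L (1 - z) = (if \<alpha> \<noteq> 1
             then exp ((z - 1) * \<delta> - sec (pi * \<alpha> / 2) * \<sigma> powr \<alpha> * (1 - z) powr \<alpha>)
             else exp ((z - 1) * \<delta> + \<sigma> * (2 / pi) * (1 - z) * ln (1 - z)))" for z
    by (simp add: L_def \<kappa>_def)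
  ultimately show ?thesis
    using laplace(1) L existence pgf by presburger
qed

end
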